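(* Let $A\in\mathbb{R}^{n\times m}$ with $n\ge m$ have rank $r$ and singular values $\sigma_1\ge\sigma_2\ge\dots$, let $1\le k\le r$, let $A_k$ be the rank-$k$ truncated SVD of $A$, and let $\tilde A_k$ be a rank-$k$ randomized SVD (RSVD) approximation of $A$ (as defined in the context). Let $x^\dag\in\mathbb{R}^m$, $b^\dag=Ax^\dag$, $b=b^\dag+e$ with $e\in\mathbb{R}^n$, and $\delta=\|e\|$. Suppose that $x^\dag=A^*w$ for some $w\in\mathbb{R}^n$ and that $\|A-\tilde A_k\|\le \sigma_k/2$. Then the truncated RSVD approximation $\tilde x_k=A^*(\tilde A_k\tilde A_k^* )^\dag b$ satisfies $$\|x^\dag-\tilde x_k\|\le 4\delta\sigma_k^{-1}+8\sigma_1\sigma_k^{-1}\|A_k-\tilde A_k\|\,\|w\|+\sigma_{k+1}\|w\|.$$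
   Context: $\|\cdot\|$ is the Euclidean norm for vectors and the spectral norm for matrices; $M^*$ is the transpose and $M^\dag$ the Moore–Penrose pseudoinverse of a matrix $M$. If $A=U\Sigma V^*$ is an SVD with singular values in nonincreasing order, then $A_k=U_k\Sigma_kV_k^*$, where $U_k,V_k$ consist of the first $k$ columns of $U,V$ and $\Sigma_k=\mathrm{diag}(\sigma_1,\dots,\sigma_k)$. By convention $\sigma_{k+1}=0$ if $k+1>\min(m,n)$. RSVD approximation of rank $k$: fix integers $p\ge0$, $q\ge0$ with $k+p\le m$. Given a matrix $\Omega\in\mathbb{R}^{m\times(k+p)}$ (a realization of a standard Gaussian matrix), form $Y=(AA^* )^qA\Omega$; let $Q\in\mathbb{R}^{n\times(k+p)}$ have orthonormal columns whose span contains the range of $Y$ (an orthonormal basis of the range of $Y$ when $Y$ has full column rank, as computed by QR); form $C=Q^*A$ and an SVD $C=WSV^*$ with $W,S\in\mathbb{R}^{(k+p)\times(k+p)}$, $V\in\mathbb{R}^{m\times(k+p)}$ and singular values in nonincreasing order. Let $\tilde U_k$ be the first $k$ columns of $QW$, $\tilde\Sigma_k$ the leading $k\times k$ block of $S$, $\tilde V_k$ the first $k$ columns of $V$, and $\tilde A_k=\tilde U_k\tilde\Sigma_k\tilde V_k^*$. By construction $\tilde A_k=\tilde P_kA$, where $\tilde P_k=\tilde U_k\tilde U_k^*$ is the orthogonal projection onto the range of $\tilde U_k$. The claim is deterministic: it holds for every realization satisfying the hypotheses. *)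

theory Defs
  imports Complex_Main "Jordan_Normal_Form.DL_Rank"
begin

definition vnorm :: "real vec \<Rightarrow> real" where
  "vnorm v = sqrt (v \<bullet> v)"

definition spectral_norm :: "real mat \<Rightarrow> real" where
  "spectral_norm M = (SUP x \<in> {x \<in> carrier_vec (dim_col M). vnorm x \<le> 1}. vnorm (M *\<^sub>v x))"

text \<open>The four Penrose conditions, which determine the pseudoinverse uniquely.\<close>

definition is_pinv :: "real mat \<Rightarrow> real mat \<Rightarrow> bool" where
  "is_pinv M X \<longleftrightarrow>
     X \<in> carrier_mat (dim_col M) (dim_row M) \<and>
     M * X * M = M \<and> X * M * X = X \<and>
     (M * X)\<^sup>T = M * X \<and> (X * M)\<^sup>T = X * M"

definition pinv :: "real mat \<Rightarrow> real mat" where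
  "pinv M = (THE X. is_pinv M X)"

definition orthonormal_cols :: "real mat \<Rightarrow> bool" where
  "orthonormal_cols M \<longleftrightarrow> M\<^sup>T * M = 1\<^sub>m (dim_col M)"

text \<open>
  The economy-size SVD: an \<open>a \<times> b\<close> matrix has a square diagonal factor of size
  \<open>min a b\<close>. It yields the same singular values and the same truncations as the SVD with
  square orthogonal factors.
\<close>

definition is_svd :: "real mat \<Rightarrow> real mat \<Rightarrow> real mat \<Rightarrow> real mat \<Rightarrow> bool" where
  "is_svd M U S V \<longleftrightarrow>
     (let l = min (dim_row M) (dim_col M) in
        U \<in> carrier_mat (dim_row M) l \<and> S \<in> carrier_mat l l \<and> V \<in> carrier_mat (dim_col M) l \<and>
        orthonormal_cols U \<and> orthonormal_cols V \<and>
        diagonal_mat S \<and>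
        (\<forall>i<l. 0 \<le> S $$ (i, i)) \<and>
        (\<forall>i j. i \<le> j \<longrightarrow> j < l \<longrightarrow> S $$ (j, j) \<le> S $$ (i, i)) \<and>
        M = U * S * V\<^sup>T)"

text \<open>
  The singular value \<open>\<sigma>\<^sub>i\<close>, read off the diagonal factor \<open>S\<close> of an SVD. Singular values are
  numbered from 1, matrix entries from 0.
\<close>

definition sing_val :: "real mat \<Rightarrow> nat \<Rightarrow> real" where
  "sing_val S i = (if 1 \<le> i \<and> i \<le> dim_row S then S $$ (i - 1, i - 1) else 0)"

definition first_cols :: "nat \<Rightarrow> real mat \<Rightarrow> real mat" where
  "first_cols k M = mat (dim_row M) k (\<lambda>(i, j). M $$ (i, j))"

definition lead_block :: "nat \<Rightarrow> real mat \<Rightarrow> real mat" where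
  "lead_block k M = mat k k (\<lambda>(i, j). M $$ (i, j))"

definition svd_trunc :: "nat \<Rightarrow> real mat \<Rightarrow> real mat \<Rightarrow> real mat \<Rightarrow> real mat" where
  "svd_trunc k U S V = first_cols k U * lead_block k S * (first_cols k V)\<^sup>T"

text \<open>
  \<open>B\<close> is an output of the randomized SVD of \<open>A\<close> with target rank \<open>k\<close>, oversampling \<open>p\<close> and
  \<open>q\<close> power iterations, for some test matrix \<open>\<Omega>\<close> and some admissible choice of the
  (non-unique) factors \<open>Q\<close>, \<open>W\<close>, \<open>S\<close>, \<open>V\<close>. If \<open>Y\<close> has full column rank, the inclusion of ranges
  is an equality for dimension reasons.
\<close>

definition is_rsvd :: "real mat \<Rightarrow> nat \<Rightarrow> nat \<Rightarrow> nat \<Rightarrow> real mat \<Rightarrow> bool" where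
  "is_rsvd A k p q B \<longleftrightarrow>
     (\<exists>\<Omega> Q W S V.
        \<Omega> \<in> carrier_mat (dim_col A) (k + p) \<and>
        Q \<in> carrier_mat (dim_row A) (k + p) \<and>
        orthonormal_cols Q \<and>
        vec_space.col_space (dim_row A) ((A * A\<^sup>T) ^\<^sub>m q * A * \<Omega>)
          \<subseteq> vec_space.col_space (dim_row A) Q \<and>
        is_svd (Q\<^sup>T * A) W S V \<and>
        B = svd_trunc k (Q * W) S V)"

end

theory Submission
  imports Defs "HOL-Analysis.L2_Norm"
begin

text \<open>
  Write the RSVD approximation as \<open>B = U' D V'\<^sup>T\<close>. Since \<open>U'\<^sup>T A = D V'\<^sup>T\<close>, the reconstruction is
  \<open>V' V'\<^sup>T x + V' D\<^sup>-\<^sup>1 U'\<^sup>T e\<close>, where \<open>x\<close> is the exact solution. The noise term is controlled by Weyl's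
  inequality \<open>D\<^sub>k\<^sub>k \<ge> \<sigma>\<^sub>k - \<parallel>A - B\<parallel> \<ge> \<sigma>\<^sub>k / 2\<close>. The projection \<open>I - V' V'\<^sup>T\<close> annihilates \<open>B\<^sup>T\<close>, so applied to
  \<open>x = A\<^sup>T w\<close> it only leaves the contributions of \<open>(A\<^sub>k - B)\<^sup>T w\<close> and \<open>(A - A\<^sub>k)\<^sup>T w\<close>. This gives the
  bound with the smaller constants 2 and 1 in place of 4 and \<open>8 \<sigma>\<^sub>1 / \<sigma>\<^sub>k\<close>.
\<close>

section \<open>Matrix products with dimension side conditions\<close>

text \<open>Stating the premises as equations between dimensions, not as carrier membership, lets
  the simplifier discharge them when long products are regrouped. The next two rules have the same
  form for the same reason.\<close>

lemma assoc_mult_mat_dim: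
  "dim_col A = dim_row B \<Longrightarrow> dim_col B = dim_row C \<Longrightarrow> (A * B) * C = A * (B * C)"
  by (rule assoc_mult_mat[of _ "dim_row A" "dim_col A" _ "dim_col B" _ "dim_col C"]) auto

lemma assoc_mult_mat_vec_dim:
  "dim_col A = dim_row B \<Longrightarrow> dim_col B = dim_vec v \<Longrightarrow> (A * B) *\<^sub>v v = A *\<^sub>v (B *\<^sub>v v)"
  by (rule assoc_mult_mat_vec[of _ "dim_row A" "dim_col A" _ "dim_col B"]) auto

lemma transpose_mult_dim:
  "dim_col A = dim_row B \<Longrightarrow> (A * B)\<^sup>T = (B\<^sup>T * A\<^sup>T :: 'a :: comm_semiring_0 mat)"
  by (rule transpose_mult[of _ "dim_row A" "dim_col A" _ "dim_col B"]) auto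

section \<open>The Euclidean norm\<close>

lemma vnorm_eq_L2_set: "vnorm v = L2_set (\<lambda>i. v $ i) {0..<dim_vec v}"
  unfolding vnorm_def L2_set_def scalar_prod_def by (simp add: power2_eq_square)

lemma vnorm_ge_0 [simp]: "0 \<le> vnorm v"
  by (simp add: vnorm_eq_L2_set)

lemma vnorm_square: "(vnorm v)\<^sup>2 = v \<bullet> v"
  unfolding vnorm_def by (simp add: scalar_prod_def sum_nonneg)

lemma scalar_prod_le_vnorm:
  assumes "x \<in> carrier_vec n" "y \<in> carrier_vec n"
  shows "x \<bullet> y \<le> vnorm x * vnorm y"
proof -
  have "x \<bullet> y = (\<Sum>i\<in>{0..<n}. x $ i * y $ i)"
    using assms by (simp add: scalar_prod_def)
  also have "\<dots> \<le> (\<Sum>i\<in>{0..<n}. \<bar>x $ i\<bar> * \<bar>y $ i\<bar>)"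
    by (intro sum_mono) (metis abs_ge_self abs_mult)
  also have "\<dots> \<le> vnorm x * vnorm y"
    using L2_set_mult_ineq[of "\<lambda>i. x $ i" "\<lambda>i. y $ i" "{0..<n}"] assms
    by (simp add: vnorm_eq_L2_set)
  finally show ?thesis .
qed

lemma vnorm_triangle_add:
  assumes "x \<in> carrier_vec n" "y \<in> carrier_vec n"
  shows "vnorm (x + y) \<le> vnorm x + vnorm y"
proof -
  have "vnorm (x + y) = L2_set (\<lambda>i. x $ i + y $ i) {0..<n}"
    using assms by (auto simp: vnorm_eq_L2_set intro!: L2_set_cong)
  also have "\<dots> \<le> vnorm x + vnorm y"
    using L2_set_triangle_ineq[of "\<lambda>i. x $ i" "\<lambda>i. y $ i" "{0..<n}"] assms
    by (simp add: vnorm_eq_L2_set)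
  finally show ?thesis .
qed

lemma vnorm_smult: "vnorm (c \<cdot>\<^sub>v x) = \<bar>c\<bar> * vnorm x"
proof -
  have "(c \<cdot>\<^sub>v x) \<bullet> (c \<cdot>\<^sub>v x) = c\<^sup>2 * (x \<bullet> x)"
    by (simp add: power2_eq_square)
  then show ?thesis
    unfolding vnorm_def by (simp add: real_sqrt_mult)
qed

lemma vnorm_uminus: "vnorm (- x) = vnorm x"
  unfolding vnorm_def by simp

lemma vnorm_triangle_minus:
  assumes "x \<in> carrier_vec n" "y \<in> carrier_vec n"
  shows "vnorm (x - y) \<le> vnorm x + vnorm y"
  using vnorm_triangle_add[of x n "- y"] assms
  by (simp add: vnorm_uminus minus_add_uminus_vec)

lemma vnorm_eq_0_iff:
  assumes "x \<in> carrier_vec n"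
  shows "vnorm x = 0 \<longleftrightarrow> x = 0\<^sub>v n"
  using assms by (auto simp: vnorm_eq_L2_set L2_set_eq_0_iff)

lemma vnorm_zero [simp]: "vnorm (0\<^sub>v n) = 0"
  by (simp add: vnorm_def scalar_prod_def)

section \<open>The spectral norm\<close>

text \<open>The supremum of a set of reals is informative only if the set is bounded. Cauchy-Schwarz
  bounds each entry of \<open>M *\<^sub>v x\<close> by the norm of a row, and the Euclidean norm is
  at most the sum of the absolute entries.\<close>

lemma bdd_above_vnorm_unit_ball_image:
  "bdd_above ((\<lambda>x. vnorm (M *\<^sub>v x)) ` {x \<in> carrier_vec (dim_col M). vnorm x \<le> 1})"
proof (rule bdd_aboveI2)
  fix x assume x: "x \<in> {x \<in> carrier_vec (dim_col M). vnorm x \<le> 1}"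
  have "\<bar>row M i \<bullet> x\<bar> \<le> vnorm (row M i)" for i
  proof -
    have "\<bar>row M i \<bullet> x\<bar> \<le> vnorm (row M i) * vnorm x"
      using scalar_prod_le_vnorm[of "row M i" "dim_col M" x]
        scalar_prod_le_vnorm[of "- row M i" "dim_col M" x] x
      by (auto simp: vnorm_uminus)
    also have "\<dots> \<le> vnorm (row M i) * 1"
      using x by (intro mult_left_mono) auto
    finally show ?thesis by simp
  qed
  then have "(\<Sum>i<dim_row M. \<bar>row M i \<bullet> x\<bar>) \<le> (\<Sum>i<dim_row M. vnorm (row M i))"
    by (intro sum_mono)
  moreover have "vnorm (M *\<^sub>v x) \<le> (\<Sum>i<dim_row M. \<bar>row M i \<bullet> x\<bar>)"
    using L2_set_le_sum_abs[of "\<lambda>i. (M *\<^sub>v x) $ i" "{0..<dim_row M}"]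
    by (simp add: vnorm_eq_L2_set lessThan_atLeast0)
  ultimately show "vnorm (M *\<^sub>v x) \<le> (\<Sum>i<dim_row M. vnorm (row M i))" by linarith
qed

lemma spectral_norm_ge_0: "0 \<le> spectral_norm M"
proof -
  have "vnorm (M *\<^sub>v 0\<^sub>v (dim_col M)) \<le> spectral_norm M"
    unfolding spectral_norm_def
    by (rule cSUP_upper[OF _ bdd_above_vnorm_unit_ball_image]) simp
  then show ?thesis using vnorm_ge_0 order_trans by blast
qed

text \<open>A nonzero \<open>x\<close> is rescaled to a unit vector, where the supremum applies; a
  vector of norm 0 is treated separately.\<close>

lemma vnorm_mult_mat_vec_le:
  assumes M: "M \<in> carrier_mat n m" and x: "x \<in> carrier_vec m"
  shows "vnorm (M *\<^sub>v x) \<le> spectral_norm M * vnorm x"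
proof (cases "vnorm x = 0")
  case True
  then have "M *\<^sub>v x = 0\<^sub>v n" using M x by (auto simp: vnorm_eq_0_iff[OF x])
  then show ?thesis using True by simp
next
  case False
  then have pos: "vnorm x > 0" by (simp add: less_le)
  define u where "u = (1 / vnorm x) \<cdot>\<^sub>v x"
  have "vnorm (M *\<^sub>v u) \<le> spectral_norm M"
    unfolding spectral_norm_def u_def
    by (rule cSUP_upper[OF _ bdd_above_vnorm_unit_ball_image])
       (use M x pos in \<open>simp add: vnorm_smult\<close>)
  moreover have "vnorm (M *\<^sub>v u) = vnorm (M *\<^sub>v x) / vnorm x"
    unfolding u_def mult_mat_vec[OF M x] by (simp add: vnorm_smult)
  ultimately show ?thesis using pos by (simp add: field_simps)
qed

text \<open>Moving \<open>M\<close> across the inner product and applying Cauchy-Schwarz bounds the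
  square of the left side by \<open>vnorm w * spectral_norm M\<close> times the left side itself,
  which is then cancelled.\<close>

lemma vnorm_transpose_mult_mat_vec_le:
  assumes M: "M \<in> carrier_mat n m" and w: "w \<in> carrier_vec n"
  shows "vnorm (M\<^sup>T *\<^sub>v w) \<le> spectral_norm M * vnorm w"
proof (cases "vnorm (M\<^sup>T *\<^sub>v w) = 0")
  case True
  then show ?thesis by (simp add: spectral_norm_ge_0)
next
  case False
  then have pos: "vnorm (M\<^sup>T *\<^sub>v w) > 0" by (simp add: less_le)
  have Mw: "M\<^sup>T *\<^sub>v w \<in> carrier_vec m" using M w by auto
  have "(vnorm (M\<^sup>T *\<^sub>v w))\<^sup>2 = w \<bullet> (M *\<^sub>v (M\<^sup>T *\<^sub>v w))"
    unfolding vnorm_square by (rule transpose_vec_mult_scalar[OF M Mw w])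
  also have "\<dots> \<le> vnorm w * vnorm (M *\<^sub>v (M\<^sup>T *\<^sub>v w))"
    by (rule scalar_prod_le_vnorm[OF w]) (use M Mw in auto)
  also have "\<dots> \<le> vnorm w * (spectral_norm M * vnorm (M\<^sup>T *\<^sub>v w))"
    by (intro mult_left_mono vnorm_mult_mat_vec_le[OF M Mw]) simp
  finally show ?thesis using pos by (simp add: power2_eq_square mult_ac)
qed

section \<open>Matrices with orthonormal columns\<close>

lemma orthonormal_cols_mult_vec:
  assumes "V \<in> carrier_mat m l" "orthonormal_cols V" "x \<in> carrier_vec l"
  shows "V\<^sup>T *\<^sub>v (V *\<^sub>v x) = x"
  using assms assoc_mult_mat_vec[of "V\<^sup>T" l m V l x] by (simp add: orthonormal_cols_def)

lemma vnorm_orthonormal_mult_vec: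
  assumes V: "V \<in> carrier_mat m l" "orthonormal_cols V" and x: "x \<in> carrier_vec l"
  shows "vnorm (V *\<^sub>v x) = vnorm x"
proof -
  have "(V\<^sup>T *\<^sub>v (V *\<^sub>v x)) \<bullet> x = (V *\<^sub>v x) \<bullet> (V *\<^sub>v x)"
    using V x by (intro transpose_vec_mult_scalar) auto
  then show ?thesis
    unfolding vnorm_def orthonormal_cols_mult_vec[OF V x] by simp
qed

text \<open>Pythagoras for the orthogonal projection \<open>V * V\<^sup>T\<close>. That
  \<open>V\<^sup>T\<close> and the complementary projection are both contractions is read off from
  it.\<close>

lemma vnorm_orthonormal_complement:
  assumes V: "V \<in> carrier_mat m l" "orthonormal_cols V" and x: "x \<in> carrier_vec m"
  shows "(vnorm (x - V *\<^sub>v (V\<^sup>T *\<^sub>v x)))\<^sup>2 = (vnorm x)\<^sup>2 - (vnorm (V\<^sup>T *\<^sub>v x))\<^sup>2"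
proof -
  define y where "y = V\<^sup>T *\<^sub>v x"
  have y: "y \<in> carrier_vec l" and Vy: "V *\<^sub>v y \<in> carrier_vec m"
    using V x unfolding y_def by auto
  have "x \<bullet> (V *\<^sub>v y) = y \<bullet> y"
    using transpose_vec_mult_scalar[OF V(1) y x] by (simp add: y_def)
  moreover have "(V *\<^sub>v y) \<bullet> (V *\<^sub>v y) = y \<bullet> y"
    using vnorm_orthonormal_mult_vec[OF V y] by (metis vnorm_square)
  moreover have "(V *\<^sub>v y) \<bullet> x = x \<bullet> (V *\<^sub>v y)"
    by (rule comm_scalar_prod[OF Vy x])
  ultimately show ?thesis
    unfolding vnorm_square y_def[symmetric]
    using x Vy by (simp add: minus_scalar_prod_distrib[of _ m] scalar_prod_minus_distrib[of _ m])
qed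

lemma vnorm_orthonormal_transpose_le:
  assumes "V \<in> carrier_mat m l" "orthonormal_cols V" "x \<in> carrier_vec m"
  shows "vnorm (V\<^sup>T *\<^sub>v x) \<le> vnorm x"
  using vnorm_orthonormal_complement[OF assms]
  by (metis diff_ge_0_iff_ge power2_le_imp_le vnorm_ge_0 zero_le_power2)

lemma vnorm_orthonormal_complement_le:
  assumes "V \<in> carrier_mat m l" "orthonormal_cols V" "x \<in> carrier_vec m"
  shows "vnorm (x - V *\<^sub>v (V\<^sup>T *\<^sub>v x)) \<le> vnorm x"
  using vnorm_orthonormal_complement[OF assms] zero_le_power2[of "vnorm (V\<^sup>T *\<^sub>v x)"]
  by (intro power2_le_imp_le[OF _ vnorm_ge_0]) linarith

section \<open>Diagonal matrices\<close>

lemma mat_diag_mult_vec_index: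
  assumes "x \<in> carrier_vec l" "i < l"
  shows "(mat_diag l d *\<^sub>v x) $ i = d i * x $ i"
proof -
  have "(mat_diag l d *\<^sub>v x) $ i = (\<Sum>j\<in>{0..<l}. (if i = j then d j else 0) * x $ j)"
    using assms by (simp add: mat_diag_def scalar_prod_def)
  also have "\<dots> = (\<Sum>j\<in>{0..<l}. if i = j then d j * x $ j else 0)"
    by (intro sum.cong) auto
  finally show ?thesis using assms by simp
qed

lemma mat_diag_dims [simp]: "dim_row (mat_diag l d) = l" "dim_col (mat_diag l d) = l"
  by (simp_all add: mat_diag_def)

lemma transpose_mat_diag [simp]: "(mat_diag l d)\<^sup>T = mat_diag l d"
  by (rule eq_matI) (auto simp: mat_diag_def)

text \<open>The entries of \<open>d\<close> are constrained only on the support of \<open>x\<close>.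
  Weyl's inequality relies on this, here and in the lower bound \<open>vnorm_mat_diag_ge\<close>,
  since its test vector is chosen to have a prescribed support.\<close>

lemma vnorm_mat_diag_le:
  assumes x: "x \<in> carrier_vec l" and c: "0 \<le> c"
    and d: "\<And>i. i < l \<Longrightarrow> x $ i \<noteq> 0 \<Longrightarrow> \<bar>d i\<bar> \<le> c"
  shows "vnorm (mat_diag l d *\<^sub>v x) \<le> c * vnorm x"
proof -
  have "(\<Sum>i\<in>{0..<l}. (d i * x $ i)\<^sup>2) \<le> (\<Sum>i\<in>{0..<l}. (c * x $ i)\<^sup>2)"
  proof (rule sum_mono)
    fix i assume "i \<in> {0..<l}"
    then show "(d i * x $ i)\<^sup>2 \<le> (c * x $ i)\<^sup>2"
      using d[of i] c
      by (cases "x $ i = 0") (auto simp: power_mult_distrib abs_le_square_iff[symmetric] intro!: mult_right_mono)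
  qed
  then have "L2_set (\<lambda>i. d i * x $ i) {0..<l} \<le> L2_set (\<lambda>i. c * x $ i) {0..<l}"
    by (simp add: L2_set_def)
  also have "\<dots> = c * vnorm x"
    using x c by (simp add: vnorm_eq_L2_set L2_set_right_distrib)
  finally show ?thesis
    using x by (simp add: vnorm_eq_L2_set mat_diag_mult_vec_index
        del: index_mult_mat_vec cong: L2_set_cong_simp)
qed

lemma vnorm_mat_diag_ge:
  assumes x: "x \<in> carrier_vec l" and c: "0 \<le> c"
    and d: "\<And>i. i < l \<Longrightarrow> x $ i \<noteq> 0 \<Longrightarrow> c \<le> d i"
  shows "c * vnorm x \<le> vnorm (mat_diag l d *\<^sub>v x)"
proof -
  have "(\<Sum>i\<in>{0..<l}. (c * x $ i)\<^sup>2) \<le> (\<Sum>i\<in>{0..<l}. (d i * x $ i)\<^sup>2)"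
  proof (rule sum_mono)
    fix i assume "i \<in> {0..<l}"
    then show "(c * x $ i)\<^sup>2 \<le> (d i * x $ i)\<^sup>2"
      using d[of i] c
      by (cases "x $ i = 0") (auto simp: power_mult_distrib intro!: mult_right_mono power_mono)
  qed
  then have "L2_set (\<lambda>i. c * x $ i) {0..<l} \<le> L2_set (\<lambda>i. d i * x $ i) {0..<l}"
    by (simp add: L2_set_def)
  moreover have "L2_set (\<lambda>i. c * x $ i) {0..<l} = c * vnorm x"
    using x c by (simp add: vnorm_eq_L2_set L2_set_right_distrib)
  ultimately show ?thesis
    using x by (simp add: vnorm_eq_L2_set mat_diag_mult_vec_index
        del: index_mult_mat_vec cong: L2_set_cong_simp)
qed

section \<open>The Moore-Penrose pseudoinverse\<close>

lemma is_pinvD: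
  assumes "is_pinv M X"
  shows "X \<in> carrier_mat (dim_col M) (dim_row M)" "M * X * M = M" "X * M * X = X"
    "(M * X)\<^sup>T = M * X" "(X * M)\<^sup>T = X * M"
  using assms unfolding is_pinv_def by blast+

text \<open>Any two solutions \<open>X\<close> and \<open>Y\<close> of the Penrose conditions induce
  the same projections, \<open>M * X = M * Y\<close> and \<open>X * M = Y * M\<close>. Then
  \<open>Y = Y * M * Y = X * M * Y = X * M * X = X\<close>, so the definite description is settled
  by any solution.\<close>

lemma pinv_eqI:
  assumes X: "is_pinv M X"
  shows "pinv M = X"
  unfolding pinv_def
proof (rule the_equality, rule X)
  fix Y assume Y: "is_pinv M Y"
  note [simp] = carrier_matD[OF is_pinvD(1)[OF X]] carrier_matD[OF is_pinvD(1)[OF Y]]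
  note [simp del] = assoc_mult_mat
  have "M * X = (M * Y * M) * X" by (simp only: is_pinvD(2)[OF Y])
  also have "\<dots> = (M * Y) * (M * X)" by (simp add: assoc_mult_mat_dim)
  \<comment> \<open>Symmetry of both factors reverses the product under the transpose, after which
    \<open>M * X * M\<close> collapses to \<open>M\<close>.\<close>
  also have "\<dots> = (M * Y)\<^sup>T * (M * X)\<^sup>T"
    by (simp only: is_pinvD(4)[OF X] is_pinvD(4)[OF Y])
  also have "\<dots> = ((M * X) * (M * Y))\<^sup>T" by (rule transpose_mult_dim[symmetric]) simp
  also have "(M * X) * (M * Y) = (M * X * M) * Y" by (simp add: assoc_mult_mat_dim)
  also have "\<dots> = M * Y" by (simp only: is_pinvD(2)[OF X])
  also have "(M * Y)\<^sup>T = M * Y" by (rule is_pinvD(4)[OF Y])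
  finally have left: "M * X = M * Y" .
  have "X * M = X * (M * Y * M)" by (simp only: is_pinvD(2)[OF Y])
  also have "\<dots> = (X * M) * (Y * M)" by (simp add: assoc_mult_mat_dim)
  also have "\<dots> = (X * M)\<^sup>T * (Y * M)\<^sup>T"
    by (simp only: is_pinvD(5)[OF X] is_pinvD(5)[OF Y])
  also have "\<dots> = ((Y * M) * (X * M))\<^sup>T" by (rule transpose_mult_dim[symmetric]) simp
  also have "(Y * M) * (X * M) = Y * (M * X * M)" by (simp add: assoc_mult_mat_dim)
  also have "\<dots> = Y * M" by (simp only: is_pinvD(2)[OF X])
  also have "(Y * M)\<^sup>T = Y * M" by (rule is_pinvD(5)[OF Y])
  finally have right: "X * M = Y * M" .
  have "Y = Y * M * Y" by (rule is_pinvD(3)[OF Y, symmetric])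
  also have "\<dots> = X * (M * Y)" by (simp add: right[symmetric] assoc_mult_mat_dim)
  also have "\<dots> = X * M * X" by (simp add: left[symmetric] assoc_mult_mat_dim)
  also have "\<dots> = X" by (rule is_pinvD(3)[OF X])
  finally show "Y = X" .
qed

text \<open>Matrices \<open>U * mat_diag k f * U\<^sup>T\<close> with a fixed \<open>U\<close> are
  symmetric and multiply by multiplying the diagonals. The Penrose conditions thus reduce to
  identities between numbers.\<close>

lemma pinv_orthonormal_diag:
  assumes U: "U \<in> carrier_mat n k" "orthonormal_cols U" and d: "\<And>i. i < k \<Longrightarrow> d i \<noteq> 0"
  shows "pinv (U * mat_diag k d * U\<^sup>T) = U * mat_diag k (\<lambda>i. inverse (d i)) * U\<^sup>T"
proof (rule pinv_eqI)
  have UU: "U\<^sup>T * U = 1\<^sub>m k"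
    using U by (simp add: orthonormal_cols_def)
  have mult: "(U * mat_diag k f * U\<^sup>T) * (U * mat_diag k g * U\<^sup>T)
      = U * mat_diag k (\<lambda>i. f i * g i) * U\<^sup>T" for f g
  proof -
    have "(U * mat_diag k f * U\<^sup>T) * (U * mat_diag k g * U\<^sup>T)
        = U * (mat_diag k f * ((U\<^sup>T * U) * (mat_diag k g * U\<^sup>T)))"
      using U(1) by (simp add: assoc_mult_mat_dim del: assoc_mult_mat)
    also have "(U\<^sup>T * U) * (mat_diag k g * U\<^sup>T) = mat_diag k g * U\<^sup>T"
      unfolding UU using U(1) by (intro left_mult_one_mat) auto
    also have "U * (mat_diag k f * (mat_diag k g * U\<^sup>T)) = U * (mat_diag k f * mat_diag k g) * U\<^sup>T"
      using U(1) by (simp add: assoc_mult_mat_dim del: assoc_mult_mat mat_diag_diag)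
    finally show ?thesis by simp
  qed
  have trans: "(U * mat_diag k f * U\<^sup>T)\<^sup>T = U * mat_diag k f * U\<^sup>T" for f
    using U(1) by (simp add: transpose_mult_dim assoc_mult_mat_dim del: assoc_mult_mat)
  have "mat_diag k (\<lambda>i. d i * inverse (d i) * d i) = mat_diag k d"
    "mat_diag k (\<lambda>i. inverse (d i) * d i * inverse (d i)) = mat_diag k (\<lambda>i. inverse (d i))"
    using d by (auto simp: mat_diag_def intro!: eq_matI)
  then show "is_pinv (U * mat_diag k d * U\<^sup>T) (U * mat_diag k (\<lambda>i. inverse (d i)) * U\<^sup>T)"
    unfolding is_pinv_def mult trans using U(1) by auto
qed

section \<open>Rank and the positivity of the k-th singular value\<close>

lemma mult_mat_diag_transpose_index:
  assumes "U \<in> carrier_mat n l" "V \<in> carrier_mat m l" "i < n" "j < m"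
  shows "(U * mat_diag l d * V\<^sup>T) $$ (i, j) = (\<Sum>t<l. U $$ (i, t) * d t * V $$ (j, t))"
  using assms by (simp add: mat_diag_mult_right scalar_prod_def lessThan_atLeast0)

text \<open>Each summand is an outer product, of rank at most 1, and rank is subadditive.\<close>

lemma rank_sum_products_le:
  fixes f g :: "nat \<Rightarrow> nat \<Rightarrow> real"
  shows "vec_space.rank n (mat n m (\<lambda>(i, j). \<Sum>t<l. f t i * g t j)) \<le> l"
proof (induction l)
  case 0
  have "mat n m (\<lambda>(i, j). \<Sum>t<0. f t i * g t j) = 0\<^sub>m n m"
    by (rule eq_matI) auto
  then show ?case using vec_space.rank_0I[of n m, where 'a = real] by (metis le_refl)
next
  case (Suc l)
  let ?M = "mat n m (\<lambda>(i, j). \<Sum>t<l. f t i * g t j)"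
  let ?R = "mat n m (\<lambda>(i, j). f l i * g l j)"
  have "mat n m (\<lambda>(i, j). \<Sum>t<Suc l. f t i * g t j) = ?M + ?R"
    by (rule eq_matI) auto
  moreover have "vec_space.rank n (?M + ?R) \<le> vec_space.rank n ?M + vec_space.rank n ?R"
    by (rule vec_space.rank_subadditive) auto
  moreover have "vec_space.rank n ?R \<le> 1"
    by (rule vec_space.rank_le_1_product_entries[where nc = m]) auto
  ultimately show ?case using Suc by simp
qed

text \<open>If \<open>s (k - 1)\<close> vanished, only the first \<open>k - 1\<close> outer products
  of the expansion would survive, forcing the rank below \<open>k\<close>.\<close>

lemma svd_diag_nonzero:
  fixes s :: "nat \<Rightarrow> real"
  assumes U: "U \<in> carrier_mat n l" and V: "V \<in> carrier_mat m l"
    and k: "1 \<le> k" "k \<le> l" and rank: "k \<le> vec_space.rank n (U * mat_diag l s * V\<^sup>T)"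
    and s: "\<And>i. k \<le> i \<Longrightarrow> i < l \<Longrightarrow> 0 \<le> s i \<and> s i \<le> s (k - 1)"
  shows "s (k - 1) \<noteq> 0"
proof
  assume 0: "s (k - 1) = 0"
  \<comment> \<open>Later entries are squeezed between 0 and \<open>s (k - 1) = 0\<close>.\<close>
  have tail: "s t = 0" if "k - 1 \<le> t" "t < l" for t
    proof (cases "t = k - 1")
    case False
    then have "k \<le> t" using that k by linarith
    then show ?thesis using s[of t] that 0 by simp
  qed (use 0 in simp)
  have "U * mat_diag l s * V\<^sup>T = mat n m (\<lambda>(i, j). \<Sum>t<k - 1. (U $$ (i, t) * s t) * V $$ (j, t))"
  proof (rule eq_matI)
    fix i j assume "i < dim_row (mat n m (\<lambda>(i, j). \<Sum>t<k - 1. (U $$ (i, t) * s t) * V $$ (j, t)))"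
      and "j < dim_col (mat n m (\<lambda>(i, j). \<Sum>t<k - 1. (U $$ (i, t) * s t) * V $$ (j, t)))"
    then have ij: "i < n" "j < m" by auto
    have "(\<Sum>t<l. U $$ (i, t) * s t * V $$ (j, t)) = (\<Sum>t<k - 1. U $$ (i, t) * s t * V $$ (j, t))"
      by (rule sum.mono_neutral_right) (use k tail in auto)
    then show "(U * mat_diag l s * V\<^sup>T) $$ (i, j)
        = mat n m (\<lambda>(i, j). \<Sum>t<k - 1. (U $$ (i, t) * s t) * V $$ (j, t)) $$ (i, j)"
      using ij by (simp add: mult_mat_diag_transpose_index[OF U V])
  qed (use U V in auto)
  then have "vec_space.rank n (U * mat_diag l s * V\<^sup>T) \<le> k - 1"
    by (simp only: rank_sum_products_le)
  with rank k show False by linarith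
qed

section \<open>Truncated singular value decompositions\<close>

lemma first_cols_carrier [simp]: "M \<in> carrier_mat n l \<Longrightarrow> first_cols k M \<in> carrier_mat n k"
  by (simp add: first_cols_def)

lemma lead_block_mat_diag: "k \<le> l \<Longrightarrow> lead_block k (mat_diag l d) = mat_diag k d"
  by (rule eq_matI) (auto simp: lead_block_def mat_diag_def)

lemma orthonormal_first_cols:
  assumes M: "M \<in> carrier_mat n l" "orthonormal_cols M" and k: "k \<le> l"
  shows "orthonormal_cols (first_cols k M)"
  unfolding orthonormal_cols_def
proof (rule eq_matI)
  fix i j assume "i < dim_row (1\<^sub>m (dim_col (first_cols k M)) :: real mat)"
    "j < dim_col (1\<^sub>m (dim_col (first_cols k M)) :: real mat)"
  then have ij: "i < k" "j < k" by (auto simp: first_cols_def)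
  have "((first_cols k M)\<^sup>T * first_cols k M) $$ (i, j) = (M\<^sup>T * M) $$ (i, j)"
    using ij k M(1) by (simp add: first_cols_def scalar_prod_def)
  then show "((first_cols k M)\<^sup>T * first_cols k M) $$ (i, j) = 1\<^sub>m (dim_col (first_cols k M)) $$ (i, j)"
    using ij k M unfolding orthonormal_cols_def by (simp add: first_cols_def del: index_mult_mat)
qed (auto simp: first_cols_def)

lemma orthonormal_cols_mult:
  assumes Q: "Q \<in> carrier_mat n l" "orthonormal_cols Q" and W: "W \<in> carrier_mat l k" "orthonormal_cols W"
  shows "orthonormal_cols (Q * W)"
proof -
  have "(Q * W)\<^sup>T * (Q * W) = W\<^sup>T * ((Q\<^sup>T * Q) * W)"
    using Q(1) W(1) by (simp add: transpose_mult_dim assoc_mult_mat_dim del: assoc_mult_mat)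
  also have "\<dots> = W\<^sup>T * W"
    using Q W by (simp add: orthonormal_cols_def left_mult_one_mat[of W l k])
  finally show ?thesis
    using W by (simp add: orthonormal_cols_def)
qed

lemma svd_trunc_mat_diag:
  assumes "k \<le> l"
  shows "svd_trunc k U (mat_diag l d) V = first_cols k U * mat_diag k d * (first_cols k V)\<^sup>T"
  unfolding svd_trunc_def lead_block_mat_diag[OF assms] ..

text \<open>Entrywise, both products are sums over singular triples, and the truncation is exactly
  the part with \<open>t < k\<close>.\<close>

lemma svd_trunc_residual:
  assumes U: "U \<in> carrier_mat n l" and V: "V \<in> carrier_mat m l" and k: "k \<le> l"
  shows "U * mat_diag l d * V\<^sup>T - svd_trunc k U (mat_diag l d) V
    = U * mat_diag l (\<lambda>t. if t < k then 0 else d t) * V\<^sup>T"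
proof (rule eq_matI)
  fix i j
  assume "i < dim_row (U * mat_diag l (\<lambda>t. if t < k then 0 else d t) * V\<^sup>T)"
    "j < dim_col (U * mat_diag l (\<lambda>t. if t < k then 0 else d t) * V\<^sup>T)"
  then have ij: "i < n" "j < m" using U V by auto
  have T: "svd_trunc k U (mat_diag l d) V \<in> carrier_mat n m"
    using U V by (auto simp: svd_trunc_def first_cols_def)
  have "svd_trunc k U (mat_diag l d) V $$ (i, j) = (\<Sum>t<k. U $$ (i, t) * d t * V $$ (j, t))"
    unfolding svd_trunc_mat_diag[OF k]
    using ij U V by (subst mult_mat_diag_transpose_index[of _ n k _ m]) (auto simp: first_cols_def)
  also have "\<dots> = (\<Sum>t<l. if t < k then U $$ (i, t) * d t * V $$ (j, t) else 0)"
    using k by (intro sum.mono_neutral_cong_left) auto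
  finally have "(\<Sum>t<l. U $$ (i, t) * d t * V $$ (j, t)) - svd_trunc k U (mat_diag l d) V $$ (i, j)
      = (\<Sum>t<l. U $$ (i, t) * (if t < k then 0 else d t) * V $$ (j, t))"
    by (simp add: sum_subtractf[symmetric]) (auto intro!: sum.cong)
  then show "(U * mat_diag l d * V\<^sup>T - svd_trunc k U (mat_diag l d) V) $$ (i, j)
      = (U * mat_diag l (\<lambda>t. if t < k then 0 else d t) * V\<^sup>T) $$ (i, j)"
    using ij U V T by (simp add: mult_mat_diag_transpose_index[OF U V] del: index_mult_mat)
qed (use U V in \<open>auto simp: svd_trunc_def first_cols_def\<close>)

text \<open>The transposed residual is \<open>V\<close> times a diagonal matrix vanishing at the
  first \<open>k\<close> places times \<open>U\<^sup>T\<close>; here \<open>V\<close> is an isometry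
  and \<open>U\<^sup>T\<close> a contraction.\<close>

lemma vnorm_svd_residual_transpose_le:
  assumes U: "U \<in> carrier_mat n l" "orthonormal_cols U" and V: "V \<in> carrier_mat m l" "orthonormal_cols V"
    and k: "k \<le> l" and c: "0 \<le> c" and d: "\<And>i. k \<le> i \<Longrightarrow> i < l \<Longrightarrow> \<bar>d i\<bar> \<le> c"
    and w: "w \<in> carrier_vec n"
  shows "vnorm ((U * mat_diag l d * V\<^sup>T - svd_trunc k U (mat_diag l d) V)\<^sup>T *\<^sub>v w) \<le> c * vnorm w"
proof -
  let ?D = "mat_diag l (\<lambda>t. if t < k then 0 else d t)"
  have Uw: "U\<^sup>T *\<^sub>v w \<in> carrier_vec l" using U w by simp
  have "(U * ?D * V\<^sup>T)\<^sup>T *\<^sub>v w = V *\<^sub>v (?D *\<^sub>v (U\<^sup>T *\<^sub>v w))"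
    using U(1) V(1) w
    by (simp add: transpose_mult_dim assoc_mult_mat_vec_dim del: assoc_mult_mat_vec assoc_mult_mat)
  moreover have "vnorm (V *\<^sub>v (?D *\<^sub>v (U\<^sup>T *\<^sub>v w))) = vnorm (?D *\<^sub>v (U\<^sup>T *\<^sub>v w))"
    by (rule vnorm_orthonormal_mult_vec[OF V]) (rule mult_mat_vec_carrier[OF mat_diag_dim Uw])
  moreover have "vnorm (?D *\<^sub>v (U\<^sup>T *\<^sub>v w)) \<le> c * vnorm (U\<^sup>T *\<^sub>v w)"
    by (rule vnorm_mat_diag_le[OF Uw c]) (use d c in auto)
  moreover have "c * vnorm (U\<^sup>T *\<^sub>v w) \<le> c * vnorm w"
    by (intro mult_left_mono vnorm_orthonormal_transpose_le[OF U w] c)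
  ultimately show ?thesis unfolding svd_trunc_residual[OF U(1) V(1) k] by simp
qed

text \<open>Replaces the diagonal factor by \<open>mat_diag\<close> of a function, the form in which
  the other lemmas treat singular values.\<close>

lemma is_svd_mat_diag:
  assumes svd: "is_svd M U S V" and l: "l = min (dim_row M) (dim_col M)"
  shows "U \<in> carrier_mat (dim_row M) l" "V \<in> carrier_mat (dim_col M) l"
    "orthonormal_cols U" "orthonormal_cols V"
    "S = mat_diag l (\<lambda>i. S $$ (i, i))"
    "M = U * mat_diag l (\<lambda>i. S $$ (i, i)) * V\<^sup>T"
    "\<And>i. i < l \<Longrightarrow> 0 \<le> S $$ (i, i)"
    "\<And>i j. i \<le> j \<Longrightarrow> j < l \<Longrightarrow> S $$ (j, j) \<le> S $$ (i, i)"
proof -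
  note svd' = svd[unfolded is_svd_def Let_def, folded l]
  show *: "S = mat_diag l (\<lambda>i. S $$ (i, i))"
    using svd' by (intro eq_matI) (auto simp: mat_diag_def diagonal_mat_def)
  have "M = U * S * V\<^sup>T" using svd' by blast
  then show "M = U * mat_diag l (\<lambda>i. S $$ (i, i)) * V\<^sup>T" using * by metis
qed (use svd[unfolded is_svd_def Let_def, folded l] in blast)+

section \<open>Weyl's inequality\<close>

text \<open>A zero row makes the determinant vanish. This serves as a dimension count: fewer than
  \<open>l\<close> homogeneous equations in \<open>l\<close> unknowns, padded by a zero row to a
  square system, have a nonzero solution.\<close>

lemma exists_kernel_vec_zero_row:
  fixes N :: "real mat"
  assumes N: "N \<in> carrier_mat l l" and i: "i < l" and zero: "row N i = 0\<^sub>v l"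
  obtains z where "z \<in> carrier_vec l" "z \<noteq> 0\<^sub>v l" "N *\<^sub>v z = 0\<^sub>v l"
proof -
  have "N = mat\<^sub>r l l (\<lambda>j. if j = i then 0\<^sub>v l else row N j)"
    using N zero by (intro eq_rowI) auto
  also have "det \<dots> = 0"
    using N by (intro det_row_0[OF i]) auto
  finally show ?thesis
    using det_0_iff_vec_prod_zero_field[OF N] that by auto
qed

text \<open>Weyl's inequality at index \<open>k\<close>: a vector \<open>V z\<close> in the span of the top \<open>k\<close> right singular vectors of
  the first matrix and orthogonal to the top \<open>k - 1\<close> ones of the second is stretched by at least
  \<open>s (k - 1)\<close> by the former and by at most \<open>d (k - 1)\<close> by the latter.\<close>

lemma singular_value_perturbation:
  assumes U: "U \<in> carrier_mat n l" "orthonormal_cols U" and V: "V \<in> carrier_mat m l" "orthonormal_cols V"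
    and U': "U' \<in> carrier_mat n k" "orthonormal_cols U'" and V': "V' \<in> carrier_mat m k" "orthonormal_cols V'"
    and k: "1 \<le> k" "k \<le> l"
    and s: "0 \<le> s (k - 1)" "\<And>i. i < k \<Longrightarrow> s (k - 1) \<le> s i" and d: "0 \<le> d (k - 1)"
  shows "s (k - 1) \<le> d (k - 1)
    + spectral_norm (U * mat_diag l s * V\<^sup>T - U' * mat_diag k d * V'\<^sup>T)"
proof -
  let ?A = "U * mat_diag l s * V\<^sup>T" and ?B = "U' * mat_diag k d * V'\<^sup>T"
  \<comment> \<open>Rows \<open>i < k - 1\<close> require \<open>V z\<close> to be orthogonal to
    column \<open>i\<close> of \<open>V'\<close>; rows from \<open>k - 1\<close> to
    \<open>l - 2\<close> read \<open>z $ (i + 1) = 0\<close>, which confines \<open>z\<close> to its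
    first \<open>k\<close> entries. These are \<open>l - 1\<close> conditions, and row
    \<open>l - 1\<close> is the zero padding.\<close>
  define N where "N = mat l l (\<lambda>(i, j). if i = l - 1 then 0
    else if i < k - 1 then (V'\<^sup>T * V) $$ (i, j) else if j = i + 1 then 1 else 0)"
  have N: "N \<in> carrier_mat l l" by (simp add: N_def)
  have "row N (l - 1) = 0\<^sub>v l"
    using k by (intro eq_vecI) (auto simp: N_def)
  then obtain z where z: "z \<in> carrier_vec l" "z \<noteq> 0\<^sub>v l" "N *\<^sub>v z = 0\<^sub>v l"
    using exists_kernel_vec_zero_row[OF N, of "l - 1"] k by auto
  have Nz: "(\<Sum>j\<in>{0..<l}. N $$ (i, j) * z $ j) = 0" if "i < l" for i
  proof -
    have "(N *\<^sub>v z) $ i = (\<Sum>j\<in>{0..<l}. N $$ (i, j) * z $ j)"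
      using N z(1) that by (simp add: scalar_prod_def)
    then show ?thesis using z(3) that by simp
  qed
  \<comment> \<open>The equation for entry \<open>i\<close> of \<open>z\<close> sits in row
    \<open>i - 1\<close>, hence the shift.\<close>
  have supp: "i < k" if "i < l" "z $ i \<noteq> 0" for i
  proof (rule ccontr)
    assume "\<not> i < k"
    then have "(\<Sum>j\<in>{0..<l}. N $$ (i - 1, j) * z $ j) = (\<Sum>j\<in>{0..<l}. if j = i then z $ j else 0)"
      using that k by (intro sum.cong) (auto simp: N_def)
    then show False using Nz[of "i - 1"] that by (simp add: less_imp_diff_less)
  qed
  define y where "y = V'\<^sup>T *\<^sub>v (V *\<^sub>v z)"
  have Vz: "V *\<^sub>v z \<in> carrier_vec m" and y: "y \<in> carrier_vec k"
    using V V' z by (auto simp: y_def)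
  \<comment> \<open>The first \<open>k - 1\<close> rows of \<open>N\<close> annihilate all entries
    of \<open>y\<close> except the last, so on \<open>y\<close> the diagonal factor acts as
    multiplication by \<open>d (k - 1)\<close>.\<close>
  have ysupp: "i = k - 1" if "i < k" "y $ i \<noteq> 0" for i
  proof (rule ccontr)
    assume i: "i \<noteq> k - 1"
    have "y = (V'\<^sup>T * V) *\<^sub>v z"
      using V V' z by (simp add: y_def assoc_mult_mat_vec_dim del: assoc_mult_mat_vec)
    then have "y $ i = (\<Sum>j\<in>{0..<l}. (V'\<^sup>T * V) $$ (i, j) * z $ j)"
      using V V' z that
      by (simp add: scalar_prod_def[of _ z] del: assoc_mult_mat_vec)
    also have "\<dots> = (\<Sum>j\<in>{0..<l}. N $$ (i, j) * z $ j)"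
      using that k i by (intro sum.cong) (auto simp: N_def)
    finally show False using Nz[of i] that k by simp
  qed
  have pos: "0 < vnorm z"
    using z vnorm_eq_0_iff[OF z(1)] by (simp add: less_le)
  have "?A *\<^sub>v (V *\<^sub>v z) = U *\<^sub>v (mat_diag l s *\<^sub>v (V\<^sup>T *\<^sub>v (V *\<^sub>v z)))"
    using U V z by (simp add: assoc_mult_mat_vec_dim del: assoc_mult_mat_vec assoc_mult_mat)
  also have "\<dots> = U *\<^sub>v (mat_diag l s *\<^sub>v z)"
    unfolding orthonormal_cols_mult_vec[OF V z(1)] ..
  also have "vnorm \<dots> = vnorm (mat_diag l s *\<^sub>v z)"
    by (rule vnorm_orthonormal_mult_vec[OF U]) (rule mult_mat_vec_carrier[OF mat_diag_dim z(1)])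
  finally have "s (k - 1) * vnorm z \<le> vnorm (?A *\<^sub>v (V *\<^sub>v z))"
    using vnorm_mat_diag_ge[OF z(1) s(1), of s] supp s(2) by simp
  moreover have "vnorm (?B *\<^sub>v (V *\<^sub>v z)) \<le> d (k - 1) * vnorm z"
  proof -
    have "?B *\<^sub>v (V *\<^sub>v z) = U' *\<^sub>v (mat_diag k d *\<^sub>v y)"
      using U' V' V z by (simp add: y_def assoc_mult_mat_vec_dim del: assoc_mult_mat_vec assoc_mult_mat)
    also have "vnorm \<dots> = vnorm (mat_diag k d *\<^sub>v y)"
      by (rule vnorm_orthonormal_mult_vec[OF U']) (rule mult_mat_vec_carrier[OF mat_diag_dim y])
    also have "\<dots> \<le> d (k - 1) * vnorm y"
      by (rule vnorm_mat_diag_le[OF y d]) (use ysupp d in auto)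
    also have "\<dots> \<le> d (k - 1) * vnorm (V *\<^sub>v z)"
      unfolding y_def by (intro mult_left_mono vnorm_orthonormal_transpose_le[OF V' Vz] d)
    also have "vnorm (V *\<^sub>v z) = vnorm z" by (rule vnorm_orthonormal_mult_vec[OF V z(1)])
    finally show ?thesis .
  qed
  moreover have "vnorm (?A *\<^sub>v (V *\<^sub>v z)) \<le> vnorm (?B *\<^sub>v (V *\<^sub>v z)) + spectral_norm (?A - ?B) * vnorm z"
  proof -
    have A: "?A \<in> carrier_mat n m" and B: "?B \<in> carrier_mat n m"
      using U V U' V' by auto
    have "?A *\<^sub>v (V *\<^sub>v z) = ?B *\<^sub>v (V *\<^sub>v z) + (?A - ?B) *\<^sub>v (V *\<^sub>v z)"
      unfolding minus_mult_distrib_mat_vec[OF A B Vz]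
      using U(1) U'(1) by (intro eq_vecI) auto
    moreover have "vnorm (?B *\<^sub>v (V *\<^sub>v z) + (?A - ?B) *\<^sub>v (V *\<^sub>v z))
        \<le> vnorm (?B *\<^sub>v (V *\<^sub>v z)) + vnorm ((?A - ?B) *\<^sub>v (V *\<^sub>v z))"
      by (intro vnorm_triangle_add[of _ n] mult_mat_vec_carrier[OF _ Vz] minus_carrier_mat A B)
    moreover have "vnorm ((?A - ?B) *\<^sub>v (V *\<^sub>v z)) \<le> spectral_norm (?A - ?B) * vnorm (V *\<^sub>v z)"
      by (rule vnorm_mult_mat_vec_le[OF minus_carrier_mat[OF B] Vz])
    ultimately show ?thesis by (simp add: vnorm_orthonormal_mult_vec[OF V z(1)])
  qed
  ultimately have "s (k - 1) * vnorm z \<le> (d (k - 1) + spectral_norm (?A - ?B)) * vnorm z"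
    by (simp add: algebra_simps)
  then show ?thesis using pos by simp
qed

section \<open>Structure of the randomized SVD and of the reconstruction\<close>

text \<open>From \<open>Q\<^sup>T * A = W * S * V\<^sup>T\<close> and
  \<open>W\<^sup>T * W = 1\<close> follows \<open>(Q * W)\<^sup>T * A = S * V\<^sup>T\<close>; its
  first \<open>k\<close> rows give the identity for \<open>U\<^sup>T * A\<close>. This ties the
  factors of \<open>B\<close> to \<open>A\<close> itself.\<close>

lemma rsvd_factorization:
  assumes rsvd: "is_rsvd A k p q B" and A: "A \<in> carrier_mat n m" and kp: "k + p \<le> m"
  obtains U V d where "U \<in> carrier_mat n k" "orthonormal_cols U" "V \<in> carrier_mat m k" "orthonormal_cols V"
    "B = U * mat_diag k d * V\<^sup>T" "U\<^sup>T * A = mat_diag k d * V\<^sup>T"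
    "\<And>i. i < k \<Longrightarrow> 0 \<le> d i" "\<And>i j. i \<le> j \<Longrightarrow> j < k \<Longrightarrow> d j \<le> d i"
proof -
  from rsvd A obtain Q W S V where Q: "Q \<in> carrier_mat n (k + p)" "orthonormal_cols Q"
    and svd: "is_svd (Q\<^sup>T * A) W S V" and B: "B = svd_trunc k (Q * W) S V"
    unfolding is_rsvd_def by auto
  define l where "l = k + p"
  define d where "d = (\<lambda>i. S $$ (i, i))"
  \<comment> \<open>The projected matrix is \<open>k + p\<close> by \<open>m\<close>, so
    \<open>k + p \<le> m\<close> makes the economy size exactly \<open>k + p\<close> and
    \<open>W\<close> square.\<close>
  have "l = min (dim_row (Q\<^sup>T * A)) (dim_col (Q\<^sup>T * A))"
    using Q A kp by (simp add: l_def)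
  note S = is_svd_mat_diag[OF svd this, folded d_def]
  have kl: "k \<le> l" and Q': "Q \<in> carrier_mat n l" using Q by (simp_all add: l_def)
  have W: "W \<in> carrier_mat l l" and V: "V \<in> carrier_mat m l"
    using S(1,2) Q' A by simp_all
  have QW: "Q * W \<in> carrier_mat n l" "orthonormal_cols (Q * W)"
    using Q' W orthonormal_cols_mult[OF Q' Q(2) W S(3)] by simp_all
  have "(Q * W)\<^sup>T * A = W\<^sup>T * (Q\<^sup>T * A)"
    using Q' W A by (simp add: transpose_mult_dim assoc_mult_mat_dim del: assoc_mult_mat)
  also have "\<dots> = W\<^sup>T * (W * mat_diag l d * V\<^sup>T)"
    using S(6) by metis
  also have "\<dots> = (W\<^sup>T * W) * (mat_diag l d * V\<^sup>T)"
    using W V by (simp add: assoc_mult_mat_dim del: assoc_mult_mat)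
  also have "\<dots> = mat_diag l d * V\<^sup>T"
    using W S(3) V left_mult_one_mat[of "mat_diag l d * V\<^sup>T" l m]
    by (simp add: orthonormal_cols_def)
  finally have QWA: "(Q * W)\<^sup>T * A = mat_diag l d * V\<^sup>T" .
  let ?U = "first_cols k (Q * W)" and ?V = "first_cols k V"
  have "?U\<^sup>T * A = mat_diag k d * ?V\<^sup>T"
  proof (rule eq_matI)
    fix i j assume "i < dim_row (mat_diag k d * ?V\<^sup>T)" "j < dim_col (mat_diag k d * ?V\<^sup>T)"
    then have ij: "i < k" "j < m" using V by (auto simp: first_cols_def)
    have "(?U\<^sup>T * A) $$ (i, j) = ((Q * W)\<^sup>T * A) $$ (i, j)"
      using ij kl QW(1) A by (simp add: first_cols_def scalar_prod_def del: index_mult_mat(2,3) assoc_mult_mat)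
    also have "\<dots> = d i * V $$ (j, i)"
      unfolding QWA using ij kl V by (simp add: mat_diag_mult_left[of "V\<^sup>T" l m])
    also have "\<dots> = (mat_diag k d * ?V\<^sup>T) $$ (i, j)"
      using ij kl V by (subst mat_diag_mult_left[of "?V\<^sup>T" k m]) (auto simp: first_cols_def)
    finally show "(?U\<^sup>T * A) $$ (i, j) = (mat_diag k d * ?V\<^sup>T) $$ (i, j)" .
  qed (use A V in \<open>auto simp: first_cols_def\<close>)
  moreover have "B = ?U * mat_diag k d * ?V\<^sup>T"
    using svd_trunc_mat_diag[OF kl, of "Q * W" d V] B S(5) by metis
  ultimately show ?thesis
    using that[of ?U ?V d] QW V kl S(4,7,8) orthonormal_first_cols[OF QW kl] orthonormal_first_cols[OF V S(4) kl]
    by (simp add: d_def)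
qed

text \<open>With \<open>D = mat_diag k d\<close>, the pseudoinverse of
  \<open>B * B\<^sup>T = U * D * D * U\<^sup>T\<close> inverts \<open>D\<close> twice, while
  \<open>A\<^sup>T * U = V * D\<close> restores one factor. The reconstruction operator is therefore
  \<open>V\<close> times the inverse of \<open>D\<close> times \<open>U\<^sup>T\<close>, and on
  exact data \<open>U\<^sup>T * A = D * V\<^sup>T\<close> turns it into the projection
  \<open>V * V\<^sup>T\<close>.\<close>

lemma pinv_reconstruction:
  assumes A: "A \<in> carrier_mat n m"
    and U: "U \<in> carrier_mat n k" "orthonormal_cols U" and V: "V \<in> carrier_mat m k" "orthonormal_cols V"
    and B: "B = U * mat_diag k d * V\<^sup>T" and UA: "U\<^sup>T * A = mat_diag k d * V\<^sup>T"
    and d: "\<And>i. i < k \<Longrightarrow> d i \<noteq> 0" and x: "x \<in> carrier_vec m" and e: "e \<in> carrier_vec n"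
  shows "A\<^sup>T *\<^sub>v (pinv (B * B\<^sup>T) *\<^sub>v (A *\<^sub>v x + e))
    = V *\<^sub>v (V\<^sup>T *\<^sub>v x) + V *\<^sub>v (mat_diag k (\<lambda>i. inverse (d i)) *\<^sub>v (U\<^sup>T *\<^sub>v e))"
proof -
  let ?D = "mat_diag k d" and ?F = "mat_diag k (\<lambda>i. inverse (d i))"
  note [simp del] = assoc_mult_mat assoc_mult_mat_vec
  have DF: "?D * ?F = 1\<^sub>m k" "?F * ?D = 1\<^sub>m k"
    using d by (auto simp: mat_diag_def one_mat_def simp del: mat_diag_diag
        simp add: mat_diag_diag[unfolded mat_diag_def] intro!: eq_matI)
  have "B * B\<^sup>T = U * (?D * ((V\<^sup>T * V) * (?D * U\<^sup>T)))"
    unfolding B using U(1) V(1) by (simp add: transpose_mult_dim assoc_mult_mat_dim)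
  also have "(V\<^sup>T * V) * (?D * U\<^sup>T) = ?D * U\<^sup>T"
    using U(1) V left_mult_one_mat[of "?D * U\<^sup>T" k n] by (simp add: orthonormal_cols_def)
  also have "U * (?D * (?D * U\<^sup>T)) = U * (?D * ?D) * U\<^sup>T"
    using U(1) by (simp add: assoc_mult_mat_dim del: mat_diag_diag)
  finally have "B * B\<^sup>T = U * mat_diag k (\<lambda>i. d i * d i) * U\<^sup>T" by simp
  then have "pinv (B * B\<^sup>T) = U * mat_diag k (\<lambda>i. inverse (d i * d i)) * U\<^sup>T"
    using pinv_orthonormal_diag[OF U, of "\<lambda>i. d i * d i"] d by simp
  then have pinv: "pinv (B * B\<^sup>T) = U * (?F * ?F) * U\<^sup>T" by simp
  have AU: "A\<^sup>T * U = V * ?D"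
  proof -
    have "A\<^sup>T * U = (U\<^sup>T * A)\<^sup>T" using A U(1) by (simp add: transpose_mult_dim)
    also have "\<dots> = V * ?D" unfolding UA using V(1) by (simp add: transpose_mult_dim)
    finally show ?thesis .
  qed
  define y where "y = U\<^sup>T *\<^sub>v (A *\<^sub>v x + e)"
  have y: "y \<in> carrier_vec k" using U(1) A x e by (simp add: y_def)
  have Fc: "?F *\<^sub>v v \<in> carrier_vec k" if "v \<in> carrier_vec k" for v
    using that by (rule mult_mat_vec_carrier[OF mat_diag_dim])
  have Dc: "?D *\<^sub>v v \<in> carrier_vec k" if "v \<in> carrier_vec k" for v
    using that by (rule mult_mat_vec_carrier[OF mat_diag_dim])
  have cancel: "?D *\<^sub>v (?F *\<^sub>v v) = v" "?F *\<^sub>v (?D *\<^sub>v v) = v" if "v \<in> carrier_vec k" for v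
    using that DF assoc_mult_mat_vec[of ?D k k ?F k v] assoc_mult_mat_vec[of ?F k k ?D k v] by auto
  have "y = U\<^sup>T *\<^sub>v (A *\<^sub>v x) + U\<^sup>T *\<^sub>v e"
    unfolding y_def using U(1) A x e by (intro mult_add_distrib_mat_vec[of _ k n]) auto
  also have "U\<^sup>T *\<^sub>v (A *\<^sub>v x) = (U\<^sup>T * A) *\<^sub>v x"
    using U(1) A x by (simp add: assoc_mult_mat_vec_dim)
  also have "\<dots> = ?D *\<^sub>v (V\<^sup>T *\<^sub>v x)"
    unfolding UA using V(1) x by (simp add: assoc_mult_mat_vec_dim)
  finally have y_eq: "y = ?D *\<^sub>v (V\<^sup>T *\<^sub>v x) + U\<^sup>T *\<^sub>v e" .
  have Vx: "V\<^sup>T *\<^sub>v x \<in> carrier_vec k" and Ue: "U\<^sup>T *\<^sub>v e \<in> carrier_vec k"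
    using U(1) V(1) x e by auto
  have Fy: "?F *\<^sub>v y = V\<^sup>T *\<^sub>v x + ?F *\<^sub>v (U\<^sup>T *\<^sub>v e)"
    unfolding y_eq mult_add_distrib_mat_vec[OF mat_diag_dim Dc[OF Vx] Ue] cancel(2)[OF Vx] ..
  have "pinv (B * B\<^sup>T) *\<^sub>v (A *\<^sub>v x + e) = U *\<^sub>v (?F *\<^sub>v (?F *\<^sub>v y))"
    unfolding pinv y_def using U(1) A x e
    by (simp add: assoc_mult_mat_vec_dim assoc_mult_mat_dim del: mat_diag_diag)
  also have "A\<^sup>T *\<^sub>v \<dots> = (A\<^sup>T * U) *\<^sub>v (?F *\<^sub>v (?F *\<^sub>v y))"
    using A U(1) y by (simp add: assoc_mult_mat_vec_dim)
  also have "\<dots> = V *\<^sub>v (?D *\<^sub>v (?F *\<^sub>v (?F *\<^sub>v y)))"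
    unfolding AU using V(1) y by (simp add: assoc_mult_mat_vec_dim)
  also have "\<dots> = V *\<^sub>v (V\<^sup>T *\<^sub>v x + ?F *\<^sub>v (U\<^sup>T *\<^sub>v e))"
    unfolding cancel(1)[OF Fc[OF y]] unfolding Fy ..
  also have "\<dots> = V *\<^sub>v (V\<^sup>T *\<^sub>v x) + V *\<^sub>v (?F *\<^sub>v (U\<^sup>T *\<^sub>v e))"
    by (rule mult_add_distrib_mat_vec[OF V(1) Vx Fc[OF Ue]])
  finally show ?thesis .
qed

text \<open>The comparison matrix \<open>C\<close> is arbitrary here and becomes the truncated SVD
  of \<open>A\<close> in the theorem. Splitting through \<open>C\<close> keeps the last term as a
  vector norm, which the singular values bound directly.\<close>

lemma orthonormal_complement_source_le:
  assumes A: "A \<in> carrier_mat n m" and C: "C \<in> carrier_mat n m"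
    and U: "U \<in> carrier_mat n k" and V: "V \<in> carrier_mat m k" "orthonormal_cols V"
    and B: "B = U * mat_diag k d * V\<^sup>T" and w: "w \<in> carrier_vec n"
  shows "vnorm (A\<^sup>T *\<^sub>v w - V *\<^sub>v (V\<^sup>T *\<^sub>v (A\<^sup>T *\<^sub>v w)))
    \<le> spectral_norm (C - B) * vnorm w + vnorm ((A - C)\<^sup>T *\<^sub>v w)"
proof -
  have Bc: "B \<in> carrier_mat n m" unfolding B using U V by (intro mult_carrier_mat[of _ n k]) auto
  have carrier: "M\<^sup>T *\<^sub>v w \<in> carrier_vec m" if "M \<in> carrier_mat n m" for M
    using that w by simp
  have carr: "(C - B)\<^sup>T *\<^sub>v w \<in> carrier_vec m" "(A - C)\<^sup>T *\<^sub>v w \<in> carrier_vec m"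
    using A Bc C by (auto intro!: carrier)
  define P where "P = (\<lambda>v. v - V *\<^sub>v (V\<^sup>T *\<^sub>v v))"
  have P_le: "vnorm (P v) \<le> vnorm v" and P_carrier: "P v \<in> carrier_vec m"
    if "v \<in> carrier_vec m" for v
    using vnorm_orthonormal_complement_le[OF V that] V that by (auto simp: P_def)
  have P_add: "P (v + v') = P v + P v'" if "v \<in> carrier_vec m" "v' \<in> carrier_vec m" for v v'
  proof -
    have "V *\<^sub>v (V\<^sup>T *\<^sub>v (v + v')) = V *\<^sub>v (V\<^sup>T *\<^sub>v v) + V *\<^sub>v (V\<^sup>T *\<^sub>v v')"
      using V that by (simp add: mult_add_distrib_mat_vec[of _ k m] mult_add_distrib_mat_vec[of _ m k])
    then show ?thesis
      unfolding P_def using V that by (intro eq_vecI) auto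
  qed
  \<comment> \<open>\<open>B\<^sup>T *\<^sub>v w\<close> lies in the range of \<open>V\<close>,
    which \<open>V * V\<^sup>T\<close> fixes.\<close>
  have PB: "P (B\<^sup>T *\<^sub>v w) = 0\<^sub>v m"
  proof -
    define u where "u = mat_diag k d *\<^sub>v (U\<^sup>T *\<^sub>v w)"
    have u: "u \<in> carrier_vec k"
      unfolding u_def by (rule mult_mat_vec_carrier[OF mat_diag_dim]) (use U w in simp)
    have "B\<^sup>T *\<^sub>v w = V *\<^sub>v u"
      unfolding B u_def using U V w
      by (simp add: transpose_mult_dim assoc_mult_mat_vec_dim del: assoc_mult_mat_vec assoc_mult_mat)
    then show ?thesis
      unfolding P_def using V u by (simp add: orthonormal_cols_mult_vec[OF V u])
  qed
  have "A\<^sup>T *\<^sub>v w = (B\<^sup>T *\<^sub>v w + (C - B)\<^sup>T *\<^sub>v w) + (A - C)\<^sup>T *\<^sub>v w"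
    using A Bc C w
    by (intro eq_vecI) (auto simp: transpose_minus[of _ n m] minus_mult_distrib_mat_vec[of _ m n])
  then have "P (A\<^sup>T *\<^sub>v w) = P (B\<^sup>T *\<^sub>v w) + P ((C - B)\<^sup>T *\<^sub>v w) + P ((A - C)\<^sup>T *\<^sub>v w)"
    using P_add[OF add_carrier_vec[OF carrier[OF Bc] carr(1)] carr(2)] P_add[OF carrier[OF Bc] carr(1)]
    by simp
  also have "\<dots> = P ((C - B)\<^sup>T *\<^sub>v w) + P ((A - C)\<^sup>T *\<^sub>v w)"
    unfolding PB using P_carrier[OF carr(1)] by simp
  finally have "vnorm (P (A\<^sup>T *\<^sub>v w)) \<le> vnorm (P ((C - B)\<^sup>T *\<^sub>v w)) + vnorm (P ((A - C)\<^sup>T *\<^sub>v w))"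
    using vnorm_triangle_add[OF P_carrier[OF carr(1)] P_carrier[OF carr(2)]] by simp
  moreover have "vnorm (P ((C - B)\<^sup>T *\<^sub>v w)) \<le> spectral_norm (C - B) * vnorm w"
    by (rule order_trans[OF P_le[OF carr(1)] vnorm_transpose_mult_mat_vec_le[of _ n m]])
       (use Bc C w in auto)
  moreover have "vnorm (P ((A - C)\<^sup>T *\<^sub>v w)) \<le> vnorm ((A - C)\<^sup>T *\<^sub>v w)"
    by (rule P_le[OF carr(2)])
  ultimately show ?thesis unfolding P_def by linarith
qed

section \<open>The error bound\<close>

theorem theorem4p1:
  fixes A U S V A\<^sub>k B\<^sub>k :: "real mat"
    and xd bd b e w xt :: "real vec"
    and n m r k p q :: nat
    and \<sigma> :: "nat \<Rightarrow> real"
    and \<delta> :: real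
  assumes A: "A \<in> carrier_mat n m"
    and nm: "m \<le> n"
    and rank: "vec_space.rank n A = r"
    and k: "1 \<le> k" "k \<le> r"
    and svd: "is_svd A U S V"
    and sigma: "\<sigma> = sing_val S"
    and Ak: "A\<^sub>k = svd_trunc k U S V"
    and kp: "k + p \<le> m"
    and rsvd: "is_rsvd A k p q B\<^sub>k"
    and xd: "xd \<in> carrier_vec m"
    and bd: "bd = A *\<^sub>v xd"
    and e: "e \<in> carrier_vec n"
    and b: "b = bd + e"
    and delta: "\<delta> = vnorm e"
    and w: "w \<in> carrier_vec n"
    and source: "xd = A\<^sup>T *\<^sub>v w"
    and close: "spectral_norm (A - B\<^sub>k) \<le> \<sigma> k / 2"
    and xt: "xt = A\<^sup>T *\<^sub>v (pinv (B\<^sub>k * B\<^sub>k\<^sup>T) *\<^sub>v b)"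
  shows "vnorm (xd - xt) \<le>
      4 * \<delta> * inverse (\<sigma> k)
      + 8 * \<sigma> 1 * inverse (\<sigma> k) * spectral_norm (A\<^sub>k - B\<^sub>k) * vnorm w
      + \<sigma> (k + 1) * vnorm w"
proof -
  define s where "s = (\<lambda>i. S $$ (i, i))"
  have "m = min (dim_row A) (dim_col A)" using A nm by simp
  note S = is_svd_mat_diag[OF svd this, folded s_def]
  have U: "U \<in> carrier_mat n m" and V: "V \<in> carrier_mat m m"
    using S(1,2) A by simp_all
  have km: "k \<le> m"
    using vec_space.rank_le_nc[OF A] rank k by linarith
  have dimS: "dim_row S = m"
    using S(5) by (metis mat_diag_dims(1))
  have \<sigma>k: "\<sigma> k = s (k - 1)" and \<sigma>1: "\<sigma> 1 = s 0"
    using km k dimS by (simp_all add: sigma sing_val_def s_def)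
  \<comment> \<open>For \<open>k < m\<close> the value is \<open>s k\<close>, the largest discarded
    one. For \<open>k = m\<close> it is the default 0, and the second claim is vacuous.\<close>
  have \<sigma>k1: "0 \<le> \<sigma> (k + 1)" "\<And>i. k \<le> i \<Longrightarrow> i < m \<Longrightarrow> s i \<le> \<sigma> (k + 1)"
    using S(7)[of k] S(8) dimS by (auto simp: sigma sing_val_def s_def)
  have "0 \<le> s (k - 1)" using S(7)[of "k - 1"] km k by (simp add: s_def)
  \<comment> \<open>Rank at least \<open>k\<close> enters here and makes the divisions by
    \<open>\<sigma> k\<close> legitimate.\<close>
  moreover have "s (k - 1) \<noteq> 0"
    using k km rank S(6) by (intro svd_diag_nonzero[OF U V]) (auto simp: s_def intro: S(7,8))
  ultimately have \<sigma>k_pos: "0 < \<sigma> k" by (simp add: \<sigma>k)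
  have \<sigma>1_ge: "\<sigma> k \<le> \<sigma> 1"
    unfolding \<sigma>k \<sigma>1 using S(8)[of 0 "k - 1"] km k by (simp add: s_def)
  obtain U' V' d where U': "U' \<in> carrier_mat n k" "orthonormal_cols U'"
    and V': "V' \<in> carrier_mat m k" "orthonormal_cols V'"
    and B: "B\<^sub>k = U' * mat_diag k d * V'\<^sup>T" and UA: "U'\<^sup>T * A = mat_diag k d * V'\<^sup>T"
    and d: "\<And>i. i < k \<Longrightarrow> 0 \<le> d i" "\<And>i j. i \<le> j \<Longrightarrow> j < k \<Longrightarrow> d j \<le> d i"
    using rsvd_factorization[OF rsvd A kp] by blast
  have "s (k - 1) \<le> d (k - 1) + spectral_norm (A - B\<^sub>k)"
    unfolding B
    by (subst S(6), rule singular_value_perturbation[OF U S(3) V S(4) U' V' k(1) km])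
       (use \<sigma>k_pos \<sigma>k d(1) S(8) km k in \<open>auto simp: s_def\<close>)
  then have "\<sigma> k / 2 \<le> d (k - 1)" using close by (simp add: \<sigma>k)
  \<comment> \<open>The Weyl bound concerns the last retained value; the nonincreasing order carries
    it to all of them, so each \<open>inverse (d i)\<close> is at most
    \<open>2 * inverse (\<sigma> k)\<close>.\<close>
  then have d_ge: "\<sigma> k / 2 \<le> d i" if "i < k" for i
    using d(2)[of i "k - 1"] that by force
  have Ue: "U'\<^sup>T *\<^sub>v e \<in> carrier_vec k" using U' e by simp
  let ?F = "mat_diag k (\<lambda>i. inverse (d i))"
  have noise_carrier: "?F *\<^sub>v (U'\<^sup>T *\<^sub>v e) \<in> carrier_vec k"
    by (rule mult_mat_vec_carrier[OF mat_diag_dim Ue])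
  have noise: "vnorm (V' *\<^sub>v (?F *\<^sub>v (U'\<^sup>T *\<^sub>v e))) \<le> 2 * inverse (\<sigma> k) * \<delta>"
  proof -
    have "vnorm (V' *\<^sub>v (?F *\<^sub>v (U'\<^sup>T *\<^sub>v e))) = vnorm (?F *\<^sub>v (U'\<^sup>T *\<^sub>v e))"
      by (rule vnorm_orthonormal_mult_vec[OF V' noise_carrier])
    also have "\<dots> \<le> 2 * inverse (\<sigma> k) * vnorm (U'\<^sup>T *\<^sub>v e)"
    proof (rule vnorm_mat_diag_le[OF Ue])
      fix i assume "i < k"
      then show "\<bar>inverse (d i)\<bar> \<le> 2 * inverse (\<sigma> k)"
        using d_ge[of i] le_imp_inverse_le[of "\<sigma> k / 2" "d i"] \<sigma>k_pos by (simp add: inverse_eq_divide)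
    qed (use \<sigma>k_pos in simp)
    also have "\<dots> \<le> 2 * inverse (\<sigma> k) * vnorm e"
      by (intro mult_left_mono vnorm_orthonormal_transpose_le[OF U' e]) (use \<sigma>k_pos in simp)
    finally show ?thesis by (simp add: delta)
  qed
  have "vnorm ((A - A\<^sub>k)\<^sup>T *\<^sub>v w) \<le> \<sigma> (k + 1) * vnorm w"
    unfolding Ak S(5)
    by (subst S(6), rule vnorm_svd_residual_transpose_le[OF U S(3) V S(4) km \<sigma>k1(1) _ w])
       (use \<sigma>k1(2) S(7) in \<open>auto simp: s_def\<close>)
  moreover have "A\<^sub>k \<in> carrier_mat n m"
    unfolding Ak svd_trunc_def using U V by (auto simp: first_cols_def)
  ultimately have proj: "vnorm (xd - V' *\<^sub>v (V'\<^sup>T *\<^sub>v xd))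
      \<le> spectral_norm (A\<^sub>k - B\<^sub>k) * vnorm w + \<sigma> (k + 1) * vnorm w"
    using orthonormal_complement_source_le[OF A _ U'(1) V' B w, of A\<^sub>k] source by simp
  have "xt = V' *\<^sub>v (V'\<^sup>T *\<^sub>v xd) + V' *\<^sub>v (?F *\<^sub>v (U'\<^sup>T *\<^sub>v e))"
    unfolding xt b bd
    by (rule pinv_reconstruction[OF A U' V' B UA _ xd e]) (use d_ge \<sigma>k_pos in force)
  \<comment> \<open>The error splits into the part of \<open>xd\<close> outside the range of
    \<open>V'\<close> and the propagated noise.\<close>
  then have "xd - xt = (xd - V' *\<^sub>v (V'\<^sup>T *\<^sub>v xd)) - V' *\<^sub>v (?F *\<^sub>v (U'\<^sup>T *\<^sub>v e))"
    using xd V' by (intro eq_vecI) auto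
  then have "vnorm (xd - xt) \<le> vnorm (xd - V' *\<^sub>v (V'\<^sup>T *\<^sub>v xd)) + vnorm (V' *\<^sub>v (?F *\<^sub>v (U'\<^sup>T *\<^sub>v e)))"
    using vnorm_triangle_minus[of "xd - V' *\<^sub>v (V'\<^sup>T *\<^sub>v xd)" m] xd V' noise_carrier by simp
  also note proj
  also note noise
  finally have "vnorm (xd - xt) \<le> 2 * inverse (\<sigma> k) * \<delta>
      + 1 * (spectral_norm (A\<^sub>k - B\<^sub>k) * vnorm w) + \<sigma> (k + 1) * vnorm w"
    by simp
  \<comment> \<open>The explicit factor 1 is compared with
    \<open>8 * \<sigma> 1 * inverse (\<sigma> k)\<close>, which is at least 8 because
    \<open>\<sigma> k \<le> \<sigma> 1\<close>.\<close>
  moreover have "1 * (spectral_norm (A\<^sub>k - B\<^sub>k) * vnorm w)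
      \<le> (8 * \<sigma> 1 * inverse (\<sigma> k)) * (spectral_norm (A\<^sub>k - B\<^sub>k) * vnorm w)"
    using \<sigma>k_pos \<sigma>1_ge
    by (intro mult_right_mono mult_nonneg_nonneg spectral_norm_ge_0) (auto simp: field_simps)
  moreover have "2 * inverse (\<sigma> k) * \<delta> \<le> 4 * \<delta> * inverse (\<sigma> k)"
    using \<sigma>k_pos by (simp add: delta)
  ultimately show ?thesis by (simp add: mult.assoc mult.commute[of _ \<delta>])
qed

end
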